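(* Let $n\ge 2$ be an integer and let $a=N_a(\cos\theta+\varepsilon\sin\theta)\in S_2$, where $\theta\in\mathbb{R}$ and $\varepsilon\in E_{-1}$. Then the equation $w^n=a$, with unknown $w\in C\ell_2$, has $n$ roots: $$w=\sqrt[n]{N_a}\Big(\cos\frac{\theta+2m\pi}{n}+\varepsilon\sin\frac{\theta+2m\pi}{n}\Big),\qquad m=0,1,2,\ldots,n-1.$$
   Context: $C\ell_2=C\ell_{2,0}$ is the associative unital real algebra with $\mathbb{R}$-basis $\mathbf{e}_0=1,\mathbf{e}_1,\mathbf{e}_2,\mathbf{e}_3$ and multiplication rules $\mathbf{e}_1^2=\mathbf{e}_2^2=1$, $\mathbf{e}_3^2=-1$, $\mathbf{e}_1\mathbf{e}_2=\mathbf{e}_3=-\mathbf{e}_2\mathbf{e}_1$, $\mathbf{e}_2\mathbf{e}_3=-\mathbf{e}_1=-\mathbf{e}_3\mathbf{e}_2$, $\mathbf{e}_3\mathbf{e}_1=-\mathbf{e}_2=-\mathbf{e}_1\mathbf{e}_3$. For $a=a_0+a_1\mathbf{e}_1+a_2\mathbf{e}_2+a_3\mathbf{e}_3$ with $a_i\in\mathbb{R}$: $I_a=a_0^2-a_1^2-a_2^2+a_3^2$, $N_a=\sqrt{|I_a|}$, $V_a=a_1^2+a_2^2-a_3^2$. $S_2=\{a\in C\ell_2: I_a>0,\ V_a<0\}$. $E_{-1}=\{\epsilon_1\mathbf{e}_1+\epsilon_2\mathbf{e}_2+\epsilon_3\mathbf{e}_3:\epsilon_i\in\mathbb{R},\ \epsilon_1^2+\epsilon_2^2-\epsilon_3^2=-1\}$.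 $\sqrt[n]{\cdot}$ is the real $n$th root. *)

theory Defs
  imports Complex_Main
begin

text \<open>
  The algebra \<open>Cl\<^sub>2 = Cl\<^sub>2\<^sub>,\<^sub>0\<close>, with \<open>Cl2 a\<^sub>0 a\<^sub>1 a\<^sub>2 a\<^sub>3\<close> representing
  \<open>a\<^sub>0 + a\<^sub>1 e\<^sub>1 + a\<^sub>2 e\<^sub>2 + a\<^sub>3 e\<^sub>3\<close>. The product is the bilinear extension of the
  multiplication table of the basis, which is recovered in \<open>e_mult_table\<close> below.
\<close>

datatype cl2 = Cl2 (co0: real) (co1: real) (co2: real) (co3: real)

lemma cl2_eq_iff:
  "x = y \<longleftrightarrow> co0 x = co0 y \<and> co1 x = co1 y \<and> co2 x = co2 y \<and> co3 x = co3 y"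
  by (cases x; cases y) simp

instantiation cl2 :: real_algebra_1
begin

definition zero_cl2 :: cl2 where "0 = Cl2 0 0 0 0"

definition one_cl2 :: cl2 where "1 = Cl2 1 0 0 0"

definition plus_cl2 :: "cl2 \<Rightarrow> cl2 \<Rightarrow> cl2" where
  "x + y = Cl2 (co0 x + co0 y) (co1 x + co1 y) (co2 x + co2 y) (co3 x + co3 y)"

definition uminus_cl2 :: "cl2 \<Rightarrow> cl2" where
  "- x = Cl2 (- co0 x) (- co1 x) (- co2 x) (- co3 x)"

definition minus_cl2 :: "cl2 \<Rightarrow> cl2 \<Rightarrow> cl2" where
  "x - y = Cl2 (co0 x - co0 y) (co1 x - co1 y) (co2 x - co2 y) (co3 x - co3 y)"

definition scaleR_cl2 :: "real \<Rightarrow> cl2 \<Rightarrow> cl2" where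
  "r *\<^sub>R x = Cl2 (r * co0 x) (r * co1 x) (r * co2 x) (r * co3 x)"

definition times_cl2 :: "cl2 \<Rightarrow> cl2 \<Rightarrow> cl2" where
  "x * y = Cl2
     (co0 x * co0 y + co1 x * co1 y + co2 x * co2 y - co3 x * co3 y)
     (co0 x * co1 y + co1 x * co0 y - co2 x * co3 y + co3 x * co2 y)
     (co0 x * co2 y + co2 x * co0 y + co1 x * co3 y - co3 x * co1 y)
     (co0 x * co3 y + co3 x * co0 y + co1 x * co2 y - co2 x * co1 y)"

instance
  by standard
    (simp_all add: zero_cl2_def one_cl2_def plus_cl2_def uminus_cl2_def minus_cl2_def
      scaleR_cl2_def times_cl2_def algebra_simps cl2_eq_iff)

end

lemmas cl2_op_defs = zero_cl2_def one_cl2_def plus_cl2_def uminus_cl2_def minus_cl2_def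
  scaleR_cl2_def times_cl2_def

definition e1 :: cl2 where "e1 = Cl2 0 1 0 0"
definition e2 :: cl2 where "e2 = Cl2 0 0 1 0"
definition e3 :: cl2 where "e3 = Cl2 0 0 0 1"

lemma e_mult_table:
  "e1 * e1 = 1" "e2 * e2 = 1" "e3 * e3 = - 1"
  "e1 * e2 = e3" "e2 * e1 = - e3"
  "e2 * e3 = - e1" "e3 * e2 = e1"
  "e3 * e1 = - e2" "e1 * e3 = e2"
  by (simp_all add: e1_def e2_def e3_def cl2_op_defs)

lemma cl2_basis_expansion:
  "Cl2 r0 r1 r2 r3 = r0 *\<^sub>R 1 + r1 *\<^sub>R e1 + r2 *\<^sub>R e2 + r3 *\<^sub>R e3"
  by (simp add: e1_def e2_def e3_def cl2_op_defs)

definition I_cl2 :: "cl2 \<Rightarrow> real" where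
  "I_cl2 a = (co0 a)\<^sup>2 - (co1 a)\<^sup>2 - (co2 a)\<^sup>2 + (co3 a)\<^sup>2"

definition N_cl2 :: "cl2 \<Rightarrow> real" where
  "N_cl2 a = sqrt \<bar>I_cl2 a\<bar>"

definition V_cl2 :: "cl2 \<Rightarrow> real" where
  "V_cl2 a = (co1 a)\<^sup>2 + (co2 a)\<^sup>2 - (co3 a)\<^sup>2"

definition S2 :: "cl2 set" where
  "S2 = {a. I_cl2 a > 0 \<and> V_cl2 a < 0}"

definition E_minus1 :: "cl2 set" where
  "E_minus1 = {r1 *\<^sub>R e1 + r2 *\<^sub>R e2 + r3 *\<^sub>R e3 | r1 r2 r3. r1\<^sup>2 + r2\<^sup>2 - r3\<^sup>2 = - 1}"

end

theory Submission
  imports Defs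
begin

text \<open>
  A root \<open>w\<close> of \<open>w\<^sup>n = a\<close> commutes with \<open>a\<close>. As \<open>V\<^sub>a < 0\<close>, the element \<open>a\<close> is not a scalar, so \<open>w\<close>
  commutes with \<open>\<epsilon>\<close>. The centralizer of \<open>\<epsilon>\<close> is \<open>\<real> + \<real>\<epsilon>\<close>, a copy of \<open>\<complex>\<close> because \<open>\<epsilon>\<^sup>2 = -1\<close>, and
  the equation becomes the one for the complex \<open>n\<close>-th roots of \<open>N\<^sub>a cis \<theta>\<close>.
\<close>

text \<open>The real-linear map with \<open>1 \<mapsto> 1\<close> and
  \<open>\<i> \<mapsto> \<epsilon>\<close>; it is multiplicative once
  \<open>\<epsilon> * \<epsilon> = - 1\<close>.\<close>

definition complex_embed :: "cl2 \<Rightarrow> complex \<Rightarrow> cl2" where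
  "complex_embed \<epsilon> z = of_real (Re z) + Im z *\<^sub>R \<epsilon>"

lemma of_real_cl2: "(of_real r :: cl2) = Cl2 r 0 0 0"
  by (simp add: of_real_def cl2_op_defs)

lemma E_minus1_iff:
  "\<epsilon> \<in> E_minus1 \<longleftrightarrow> co0 \<epsilon> = 0 \<and> (co1 \<epsilon>)\<^sup>2 + (co2 \<epsilon>)\<^sup>2 - (co3 \<epsilon>)\<^sup>2 = - 1"
  by (cases \<epsilon>) (auto simp: E_minus1_def e1_def e2_def e3_def cl2_op_defs)

lemma E_minus1_square:
  assumes "\<epsilon> \<in> E_minus1"
  shows "\<epsilon> * \<epsilon> = - 1"
  using assms by (simp add: E_minus1_iff cl2_op_defs power2_eq_square)

text \<open>Makes the \<open>e3\<close> coordinate usable as a denominator: it detects the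
  coefficient of \<open>\<epsilon>\<close>.\<close>

lemma E_minus1_co3_nonzero:
  assumes "\<epsilon> \<in> E_minus1"
  shows "co3 \<epsilon> \<noteq> 0"
proof
  assume "co3 \<epsilon> = 0"
  with assms have "(co1 \<epsilon>)\<^sup>2 + (co2 \<epsilon>)\<^sup>2 = - 1"
    by (simp add: E_minus1_iff)
  then show False
    using sum_power2_ge_zero[of "co1 \<epsilon>" "co2 \<epsilon>"] by linarith
qed

lemma complex_embed_one [simp]: "complex_embed \<epsilon> 1 = 1"
  by (simp add: complex_embed_def)

lemma complex_embed_mult:
  assumes "\<epsilon> \<in> E_minus1"
  shows "complex_embed \<epsilon> (y * z) = complex_embed \<epsilon> y * complex_embed \<epsilon> z"
proof -
  have "complex_embed \<epsilon> y * complex_embed \<epsilon> z =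
      of_real (Re y * Re z) + (Re y * Im z + Im y * Re z) *\<^sub>R \<epsilon> + (Im y * Im z) *\<^sub>R (\<epsilon> * \<epsilon>)"
    by (simp add: complex_embed_def of_real_def algebra_simps)
  then show ?thesis
    by (simp add: complex_embed_def E_minus1_square[OF assms] of_real_def algebra_simps)
qed

lemma complex_embed_power:
  assumes "\<epsilon> \<in> E_minus1"
  shows "complex_embed \<epsilon> (z ^ n) = complex_embed \<epsilon> z ^ n"
  by (induction n) (simp_all add: complex_embed_mult[OF assms])

text \<open>As \<open>co0 \<epsilon> = 0\<close>, coordinate 0 of the image is the real part;
  coordinate 3 is the imaginary part times \<open>co3 \<epsilon> \<noteq> 0\<close>.\<close>

lemma inj_complex_embed:
  assumes "\<epsilon> \<in> E_minus1"
  shows "inj (complex_embed \<epsilon>)"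
proof (rule injI)
  fix y z
  assume "complex_embed \<epsilon> y = complex_embed \<epsilon> z"
  then show "y = z"
    using E_minus1_co3_nonzero[OF assms] assms
    by (simp add: complex_embed_def of_real_cl2 cl2_op_defs E_minus1_iff complex_eq_iff)
qed

text \<open>Scalar parts drop out of the commutator, which then vanishes only if the vector part of
  \<open>w\<close> is a multiple of \<open>\<epsilon>\<close>.\<close>

lemma centralizer_E_minus1:
  assumes "\<epsilon> \<in> E_minus1" and comm: "w * \<epsilon> = \<epsilon> * w"
  shows "w \<in> range (complex_embed \<epsilon>)"
proof -
  have nz: "co3 \<epsilon> \<noteq> 0" and "co0 \<epsilon> = 0"
    using assms(1) by (simp_all add: E_minus1_co3_nonzero E_minus1_iff)
  \<comment> \<open>The first equation is the \<open>e2\<close> coordinate of \<open>comm\<close>,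
    the second its \<open>e1\<close> coordinate. They fix the factor of proportionality as
    \<open>co3 w / co3 \<epsilon>\<close>.\<close>
  moreover have "co1 w * co3 \<epsilon> = co3 w * co1 \<epsilon>" "co2 w * co3 \<epsilon> = co3 w * co2 \<epsilon>"
    using comm by (simp_all add: times_cl2_def algebra_simps)
  ultimately have "w = complex_embed \<epsilon> (Complex (co0 w) (co3 w / co3 \<epsilon>))"
    by (simp add: complex_embed_def of_real_cl2 cl2_op_defs cl2_eq_iff field_simps)
  then show ?thesis
    by blast
qed

text \<open>One root \<open>z\<^sub>0\<close> is found by de Moivre; division by it turns the others
  into the \<open>n\<close>-th roots of unity.\<close>

lemma complex_roots_of_polar:
  fixes r \<theta> :: real
  assumes "n > 0" "r > 0"
  shows "{z. z ^ n = of_real r * cis \<theta>} =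
      (\<lambda>m. of_real (root n r) * cis ((\<theta> + 2 * real m * pi) / real n)) ` {..<n}"
    and "card {z. z ^ n = of_real r * cis \<theta>} = n"
proof -
  define c where "c = of_real r * cis \<theta>"
  define z\<^sub>0 where "z\<^sub>0 = of_real (root n r) * cis (\<theta> / real n)"
  have "root n r > 0"
    using assms by simp
  then have nz: "z\<^sub>0 \<noteq> 0"
    by (simp add: z\<^sub>0_def)
  have z0: "z\<^sub>0 ^ n = c"
    using assms by (simp add: z\<^sub>0_def c_def power_mult_distrib Complex.DeMoivre flip: of_real_power)
  have "{z. z ^ n = c} = (*) z\<^sub>0 ` {u. u ^ n = 1}"
  proof (intro equalityI subsetI)
    fix z assume "z \<in> {z. z ^ n = c}"
    then have "(z / z\<^sub>0) ^ n = 1" "z = z\<^sub>0 * (z / z\<^sub>0)"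
      using nz z0 by (auto simp: power_divide)
    then show "z \<in> (*) z\<^sub>0 ` {u. u ^ n = 1}"
      by blast
  qed (auto simp: power_mult_distrib z0)
  also have "{u. u ^ n = 1} = (\<lambda>m. cis (2 * pi * real m / real n)) ` {..<n}"
    using bij_betw_roots_unity[OF assms(1)] by (simp add: bij_betw_def)
  finally show "{z. z ^ n = of_real r * cis \<theta>} =
      (\<lambda>m. of_real (root n r) * cis ((\<theta> + 2 * real m * pi) / real n)) ` {..<n}"
    by (simp add: c_def image_image z\<^sub>0_def mult.assoc cis_mult add_divide_distrib mult_ac)
  show "card {z. z ^ n = of_real r * cis \<theta>} = n"
    using assms by (intro card_nth_roots) auto
qed

lemma complex_embed_polar:
  "complex_embed \<epsilon> (of_real r * cis t) = r *\<^sub>R (of_real (cos t) + sin t *\<^sub>R \<epsilon>)"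
  by (simp add: complex_embed_def of_real_def algebra_simps)

theorem theorem3p2:
  fixes n :: nat and a \<epsilon> :: cl2 and \<theta> :: real
  assumes "n \<ge> 2"
    and "a \<in> S2"
    and "\<epsilon> \<in> E_minus1"
    and "a = N_cl2 a *\<^sub>R (of_real (cos \<theta>) + sin \<theta> *\<^sub>R \<epsilon>)"
  shows "{w :: cl2. w ^ n = a} =
      (\<lambda>m. root n (N_cl2 a) *\<^sub>R
          (of_real (cos ((\<theta> + 2 * real m * pi) / real n)) +
           sin ((\<theta> + 2 * real m * pi) / real n) *\<^sub>R \<epsilon>)) ` {0..n - 1}
    \<and> card {w :: cl2. w ^ n = a} = n"
proof -
  define r where "r = N_cl2 a"
  define c where "c = of_real r * cis \<theta>"
  have r: "r > 0"
    using assms(2) by (simp add: r_def S2_def N_cl2_def)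
  have n: "n > 0"
    using assms(1) by simp
  have a: "a = complex_embed \<epsilon> c"
    using assms(4) by (simp add: c_def r_def complex_embed_polar)
  have sin: "Im c \<noteq> 0"
  proof
    assume "Im c = 0"
    then have "V_cl2 a = 0"
      by (simp add: a complex_embed_def V_cl2_def of_real_cl2 cl2_op_defs)
    then show False
      using assms(2) by (simp add: S2_def)
  qed
  have range: "w \<in> range (complex_embed \<epsilon>)" if "w ^ n = a" for w
  proof (rule centralizer_E_minus1[OF assms(3)])
    have "w * a = a * w"
      using that by (metis power_commutes)
    \<comment> \<open>The scalar part of \<open>a\<close> is central and cancels from
      \<open>w * a = a * w\<close>.\<close>
    then have "Im c *\<^sub>R (w * \<epsilon>) = Im c *\<^sub>R (\<epsilon> * w)"
      by (simp add: a complex_embed_def of_real_def algebra_simps)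
    then show "w * \<epsilon> = \<epsilon> * w"
      using sin by simp
  qed
  have roots: "{w. w ^ n = a} = complex_embed \<epsilon> ` {z. z ^ n = c}"
  proof (intro equalityI subsetI)
    fix w assume "w \<in> {w. w ^ n = a}"
    then have w: "w ^ n = complex_embed \<epsilon> c"
      by (simp add: a)
    \<comment> \<open>Once \<open>w\<close> lies in the copy of the complex numbers, injectivity
      pulls the equation back to \<open>z ^ n = c\<close>.\<close>
    with range obtain z where z: "w = complex_embed \<epsilon> z"
      using a by blast
    with w have "z ^ n = c"
      using inj_complex_embed[OF assms(3)]
      by (simp add: inj_eq flip: complex_embed_power[OF assms(3)])
    with z show "w \<in> complex_embed \<epsilon> ` {z. z ^ n = c}"
      by blast
  next
    fix w assume "w \<in> complex_embed \<epsilon> ` {z. z ^ n = c}"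
    then show "w \<in> {w. w ^ n = a}"
      by (auto simp: a complex_embed_power[OF assms(3), symmetric])
  qed
  \<comment> \<open>With truncated subtraction this relies on \<open>n > 0\<close>.\<close>
  have "{0..n - 1} = {..<n}"
    using n by auto
  \<comment> \<open>Injectivity carries over the count of the complex roots, so the \<open>n\<close>
    listed values are distinct.\<close>
  moreover have "card {w. w ^ n = a} = n"
    unfolding roots
    using complex_roots_of_polar(2)[OF n r] inj_on_subset[OF inj_complex_embed[OF assms(3)]]
    by (subst card_image) (auto simp: c_def)
  ultimately show ?thesis
    unfolding roots unfolding c_def complex_roots_of_polar(1)[OF n r]
    by (simp add: image_image complex_embed_polar flip: r_def)
qed

end
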